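(* Let $G$ be a (connected) non-simple graph and let $G'$ be a connected minor graph of $G$ obtained from $G$ by removing and/or contracting a finite number of edges. Then $G$ is hyperbolic if and only if $G'$ is hyperbolic.
   Context: Non-simple graphs are graphs in which loops and multiple edges are allowed. Graphs are connected, nonempty, possibly infinite, and every edge has length $1$. $G$ is regarded as a geodesic metric space: each edge is identified with $[0,1]$ (with its two ends identified if the edge is a loop), points of $G$ are the vertices together with all interior points of edges, and $d_G$ is the shortest-path distance. Hyperbolicity: a geodesic triangle $T=\{x_1,x_2,x_3\}$ in a geodesic metric space $X$ is the union of three geodesics $[x_1x_2],[x_2x_3],[x_3x_1]$ (the vertices may be arbitrary points of $X$, possibly coinciding). $T$ is $\delta$-thin if each side is contained in the $\delta$-neighborhood of the union of the other two sides. $X$ is $\delta$-hyperbolic if every geodesic triangle in $X$ is $\delta$-thin, and hyperbolic if it is $\delta$-hyperbolic for some $\delta\ge 0$. Edge contraction (non-simple graphs): for an edge $e$ with endpoints $A,B$, $G/e$ is obtained by removing $e$ and merging $A$ and $B$ into a single vertex $V_e$, keeping all other edges: if there are $n_1\ge 1$ edges joining $v$ and $A$ and $n_2\ge 1$ edges joining $v$ and $B$, then there are $n_1+n_2$ edges joining $v$ and $V_e$ in $G/e$; each edge $e'\ne e$ joining $A$ and $B$ becomes a loop at $V_e$. Edge removal: $G\setminus e$ is the graph with $V(G\setminus e)=V(G)$ and $E(G\setminus e)=E(G)\setminus\{e\}$. *)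

theory Defs
  imports Complex_Main
begin

section \<open>Non-simple graphs\<close>

text \<open>
  Undirected graphs, loops and multiple edges allowed, no finiteness assumed. Edges are objects of
  their own. The graph is not directed: \<open>end0\<close> and \<open>end1\<close> merely record which end of the
  edge corresponds to 0 and which to 1 when the edge is identified with \<open>[0,1]\<close>.
\<close>

record ('v, 'e) graph =
  verts :: "'v set"
  edges :: "'e set"
  end0 :: "'e \<Rightarrow> 'v"
  end1 :: "'e \<Rightarrow> 'v"

definition wf_graph :: "('v, 'e) graph \<Rightarrow> bool" where
  "wf_graph G \<longleftrightarrow> (\<forall>e\<in>edges G. end0 G e \<in> verts G \<and> end1 G e \<in> verts G)"

definition adjacent :: "('v, 'e) graph \<Rightarrow> 'v \<Rightarrow> 'v \<Rightarrow> bool" where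
  "adjacent G u v \<longleftrightarrow> (\<exists>e\<in>edges G. {end0 G e, end1 G e} = {u, v})"

definition connected_graph :: "('v, 'e) graph \<Rightarrow> bool" where
  "connected_graph G \<longleftrightarrow>
     wf_graph G \<and> verts G \<noteq> {} \<and> (\<forall>u\<in>verts G. \<forall>v\<in>verts G. (adjacent G)\<^sup>*\<^sup>* u v)"

definition remove_edge :: "('v, 'e) graph \<Rightarrow> 'e \<Rightarrow> ('v, 'e) graph" where
  "remove_edge G e = G\<lparr>edges := edges G - {e}\<rparr>"

text \<open>
  The merged vertex \<open>V\<^sub>e\<close> is represented by the end \<open>end0 G e\<close>. All other edges are
  kept, so edges parallel to \<open>e\<close> become loops. Contracting a loop just removes it.
\<close>

definition merge_ends :: "('v, 'e) graph \<Rightarrow> 'e \<Rightarrow> 'v \<Rightarrow> 'v" where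
  "merge_ends G e v = (if v = end1 G e then end0 G e else v)"

definition contract_edge :: "('v, 'e) graph \<Rightarrow> 'e \<Rightarrow> ('v, 'e) graph" where
  "contract_edge G e =
     \<lparr>verts = merge_ends G e ` verts G,
      edges = edges G - {e},
      end0 = merge_ends G e \<circ> end0 G,
      end1 = merge_ends G e \<circ> end1 G\<rparr>"

inductive minor_step :: "('v, 'e) graph \<Rightarrow> ('v, 'e) graph \<Rightarrow> bool" where
  remove: "e \<in> edges G \<Longrightarrow> minor_step G (remove_edge G e)"
| contract: "e \<in> edges G \<Longrightarrow> minor_step G (contract_edge G e)"

abbreviation finite_edge_minor :: "('v, 'e) graph \<Rightarrow> ('v, 'e) graph \<Rightarrow> bool" where
  "finite_edge_minor G G' \<equiv> minor_step\<^sup>*\<^sup>* G G'"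


section \<open>The metric space of a graph\<close>

datatype ('v, 'e) point = Vertex 'v | Interior 'e real

definition points :: "('v, 'e) graph \<Rightarrow> ('v, 'e) point set" where
  "points G = Vertex ` verts G \<union> {Interior e t | e t. e \<in> edges G \<and> 0 < t \<and> t < 1}"

text \<open>The identification map from \<open>[0,1]\<close> to the closed edge \<open>e\<close>.\<close>

definition edge_point :: "('v, 'e) graph \<Rightarrow> 'e \<Rightarrow> real \<Rightarrow> ('v, 'e) point" where
  "edge_point G e t =
     (if t = 0 then Vertex (end0 G e) else if t = 1 then Vertex (end1 G e) else Interior e t)"

text \<open>
  \<open>path_length G x l y\<close>: some path from \<open>x\<close> to \<open>y\<close> made of finitely many segments,
  each contained in a closed edge of unit length, has total length \<open>l\<close>.
\<close>

inductive path_length ::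
  "('v, 'e) graph \<Rightarrow> ('v, 'e) point \<Rightarrow> real \<Rightarrow> ('v, 'e) point \<Rightarrow> bool" for G where
  trivial: "x \<in> points G \<Longrightarrow> path_length G x 0 x"
| segment: "path_length G x l (edge_point G e s) \<Longrightarrow> e \<in> edges G \<Longrightarrow>
    s \<in> {0..1} \<Longrightarrow> t \<in> {0..1} \<Longrightarrow> path_length G x (l + \<bar>s - t\<bar>) (edge_point G e t)"

definition graph_dist :: "('v, 'e) graph \<Rightarrow> ('v, 'e) point \<Rightarrow> ('v, 'e) point \<Rightarrow> real" where
  "graph_dist G x y = Inf {l. path_length G x l y}"


section \<open>Hyperbolicity\<close>

text \<open>Metric spaces are given by a carrier \<open>X\<close> and a distance function \<open>d\<close>.\<close>

definition geodesic :: "'a set \<Rightarrow> ('a \<Rightarrow> 'a \<Rightarrow> real) \<Rightarrow> 'a \<Rightarrow> 'a \<Rightarrow> 'a set \<Rightarrow> bool" where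
  "geodesic X d x y S \<longleftrightarrow>
     (\<exists>(\<gamma> :: real \<Rightarrow> 'a) l. 0 \<le> l \<and> \<gamma> ` {0..l} \<subseteq> X \<and> \<gamma> 0 = x \<and> \<gamma> l = y \<and>
        (\<forall>s\<in>{0..l}. \<forall>t\<in>{0..l}. d (\<gamma> s) (\<gamma> t) = \<bar>s - t\<bar>) \<and> S = \<gamma> ` {0..l})"

text \<open>
  Neighborhoods are closed, since \<open>\<delta> = 0\<close> is admitted (trees are to be 0-hyperbolic).
\<close>

definition neighborhood :: "'a set \<Rightarrow> ('a \<Rightarrow> 'a \<Rightarrow> real) \<Rightarrow> real \<Rightarrow> 'a set \<Rightarrow> 'a set" where
  "neighborhood X d \<delta> A = {p \<in> X. \<exists>a\<in>A. d p a \<le> \<delta>}"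

definition thin ::
  "'a set \<Rightarrow> ('a \<Rightarrow> 'a \<Rightarrow> real) \<Rightarrow> real \<Rightarrow> 'a set \<Rightarrow> 'a set \<Rightarrow> 'a set \<Rightarrow> bool" where
  "thin X d \<delta> S1 S2 S3 \<longleftrightarrow>
     S1 \<subseteq> neighborhood X d \<delta> (S2 \<union> S3) \<and>
     S2 \<subseteq> neighborhood X d \<delta> (S3 \<union> S1) \<and>
     S3 \<subseteq> neighborhood X d \<delta> (S1 \<union> S2)"

definition delta_hyperbolic :: "'a set \<Rightarrow> ('a \<Rightarrow> 'a \<Rightarrow> real) \<Rightarrow> real \<Rightarrow> bool" where
  "delta_hyperbolic X d \<delta> \<longleftrightarrow>
     (\<forall>x1\<in>X. \<forall>x2\<in>X. \<forall>x3\<in>X. \<forall>S1 S2 S3.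
        geodesic X d x1 x2 S1 \<longrightarrow> geodesic X d x2 x3 S2 \<longrightarrow> geodesic X d x3 x1 S3 \<longrightarrow>
        thin X d \<delta> S1 S2 S3)"

definition hyperbolic :: "'a set \<Rightarrow> ('a \<Rightarrow> 'a \<Rightarrow> real) \<Rightarrow> bool" where
  "hyperbolic X d \<longleftrightarrow> (\<exists>\<delta>\<ge>0. delta_hyperbolic X d \<delta>)"

abbreviation hyperbolic_graph :: "('v, 'e) graph \<Rightarrow> bool" where
  "hyperbolic_graph G \<equiv> hyperbolic (points G) (graph_dist G)"

end

theory Submission imports Defs begin

text \<open>
  A shortest path passes at most once through the removed or contracted edge, so one removal or
  contraction changes distances only by a bounded additive error. For geodesic spaces hyperbolicity
  is equivalent to Gromov's four-point condition, which survives additive errors, so stability of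
  quasi-geodesics is not needed. Removal can only disconnect and contraction preserves
  connectedness in both directions, so all intermediate graphs are connected when the last one is.
\<close>

section \<open>The four-point condition\<close>

text \<open>The four-point inequality mentions distances only, so no geodesic of one graph has to be
  matched with a geodesic of the other. Hence the separate argument that this infimum is attained.
  Distances in two graphs are compared without cutting paths at the edge \<open>e\<close>: a
  function that is 1-Lipschitz along every edge of a graph grows by at most the distance between two
  points. The functions used are the distance in the other graph and a distance with the two ends of
  \<open>e\<close> identified. The errors differ in kind. Contraction costs at most 1, the length of
  \<open>e\<close>. Removal costs the distance between the ends of \<open>e\<close> in the remaining
  graph, which is finite by connectedness but can be arbitrarily large.\<close>

definition four_point :: "'a set \<Rightarrow> ('a \<Rightarrow> 'a \<Rightarrow> real) \<Rightarrow> real \<Rightarrow> bool" where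
  "four_point X d \<delta> \<longleftrightarrow> (\<forall>x\<in>X. \<forall>y\<in>X. \<forall>z\<in>X. \<forall>w\<in>X.
     d x y + d z w \<le> max (d x z + d y w) (d x w + d y z) + \<delta>)"

locale pseudometric =
  fixes X :: "'a set" and d :: "'a \<Rightarrow> 'a \<Rightarrow> real"
  assumes refl: "x \<in> X \<Longrightarrow> d x x = 0"
    and sym: "x \<in> X \<Longrightarrow> y \<in> X \<Longrightarrow> d x y = d y x"
    and triangle: "x \<in> X \<Longrightarrow> y \<in> X \<Longrightarrow> z \<in> X \<Longrightarrow> d x z \<le> d x y + d y z"
begin

lemma nonneg: "x \<in> X \<Longrightarrow> y \<in> X \<Longrightarrow> 0 \<le> d x y"
  using triangle[of x y x] refl[of x] sym[of x y] by linarith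

lemma geodesicE:
  assumes "geodesic X d x y S"
  obtains \<gamma> where "S = \<gamma> ` {0..d x y}" "S \<subseteq> X" "x \<in> X" "y \<in> X" "0 \<le> d x y"
    "\<gamma> 0 = x" "\<gamma> (d x y) = y"
    "\<And>s t. s \<in> {0..d x y} \<Longrightarrow> t \<in> {0..d x y} \<Longrightarrow> d (\<gamma> s) (\<gamma> t) = \<bar>s - t\<bar>"
proof -
  obtain \<gamma> l where g: "0 \<le> l" "\<gamma> ` {0..l} \<subseteq> X" "\<gamma> 0 = x" "\<gamma> l = y"
    "\<forall>s\<in>{0..l}. \<forall>t\<in>{0..l}. d (\<gamma> s) (\<gamma> t) = \<bar>s - t\<bar>" "S = \<gamma> ` {0..l}"
    using assms unfolding geodesic_def by blast
  have "d (\<gamma> 0) (\<gamma> l) = \<bar>0 - l\<bar>" using g(1,5) by force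
  then have "l = d x y" using g by simp
  moreover have "x \<in> X" "y \<in> X" using g by force+
  ultimately show thesis using g by (intro that[of \<gamma>]) auto
qed

lemma geodesic_ends:
  assumes "geodesic X d x y S"
  shows "x \<in> S" "y \<in> S"
  using assms by (rule geodesicE, force)+

lemma geodesic_point:
  assumes "geodesic X d x y S" "a \<in> S"
  shows "a \<in> X" "d x a + d a y = d x y"
proof -
  obtain \<gamma> where g: "S = \<gamma> ` {0..d x y}" "S \<subseteq> X" "0 \<le> d x y" "\<gamma> 0 = x" "\<gamma> (d x y) = y"
    "\<And>s t. s \<in> {0..d x y} \<Longrightarrow> t \<in> {0..d x y} \<Longrightarrow> d (\<gamma> s) (\<gamma> t) = \<bar>s - t\<bar>"
    using geodesicE[OF assms(1)] by metis
  obtain t where t: "t \<in> {0..d x y}" "a = \<gamma> t" using assms(2) g(1) by blast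
  show "a \<in> X" using assms(2) g(2) by blast
  show "d x a + d a y = d x y"
    using g(6)[of 0 t] g(6)[of t "d x y"] g(3-5) t by auto
qed

lemma geodesic_near_point:
  assumes "geodesic X d x y S" "a \<in> S" "p \<in> X" "d p a \<le> r"
  shows "d x p + d p y \<le> d x y + 2 * r"
proof -
  have "x \<in> X" "y \<in> X" using geodesicE[OF assms(1)] by metis+
  then show ?thesis
    using geodesic_point[OF assms(1,2)] assms(3,4) triangle[of x a p] triangle[of p a y] sym[of a p]
    by linarith
qed

lemma geodesic_swap:
  assumes "geodesic X d x y S"
  shows "geodesic X d y x S"
proof -
  obtain \<gamma> l where g: "0 \<le> l" "\<gamma> ` {0..l} \<subseteq> X" "\<gamma> 0 = x" "\<gamma> l = y"
    "\<forall>s\<in>{0..l}. \<forall>t\<in>{0..l}. d (\<gamma> s) (\<gamma> t) = \<bar>s - t\<bar>" "S = \<gamma> ` {0..l}"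
    using assms unfolding geodesic_def by blast
  have im: "(\<lambda>t. \<gamma> (l - t)) ` {0..l} = \<gamma> ` {0..l}"
  proof
    show "\<gamma> ` {0..l} \<subseteq> (\<lambda>t. \<gamma> (l - t)) ` {0..l}"
    proof
      fix p assume "p \<in> \<gamma> ` {0..l}"
      then obtain t where "t \<in> {0..l}" "p = \<gamma> t" by blast
      then show "p \<in> (\<lambda>t. \<gamma> (l - t)) ` {0..l}" by (intro image_eqI[of _ _ "l - t"]) auto
    qed
  qed auto
  show ?thesis unfolding geodesic_def
    by (rule exI[of _ "\<lambda>t. \<gamma> (l - t)"], rule exI[of _ l]) (use g im in auto)
qed

section \<open>From the four-point inequality to thin triangles\<close>

text \<open>Compare \<open>p\<close> with the point \<open>q\<close> of \<open>S\<close> at the same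
  distance from \<open>x\<close>, cut off at \<open>z\<close>. In the inequality for the pairing of
  \<open>p\<close>, \<open>q\<close> against \<open>x\<close>, \<open>z\<close>, one \<delta> comes
  from \<open>four_point\<close> and one from the assumed short detour through
  \<open>p\<close>.\<close>

lemma four_point_near_side:
  assumes fp: "four_point X d \<delta>" and d0: "0 \<le> \<delta>"
    and S: "geodesic X d x z S" and p: "p \<in> X" and le: "d x p + d p z \<le> d x z + \<delta>"
  shows "\<exists>q\<in>S. d p q \<le> 2 * \<delta>"
proof -
  obtain \<gamma> where g: "S = \<gamma> ` {0..d x z}" "S \<subseteq> X" "x \<in> X" "z \<in> X" "0 \<le> d x z"
    "\<gamma> 0 = x" "\<gamma> (d x z) = z"
    "\<And>s t. s \<in> {0..d x z} \<Longrightarrow> t \<in> {0..d x z} \<Longrightarrow> d (\<gamma> s) (\<gamma> t) = \<bar>s - t\<bar>"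
    using geodesicE[OF S] by metis
  define t where "t = min (d x p) (d x z)"
  have t: "t \<in> {0..d x z}" using nonneg g p by (auto simp: t_def)
  define q where "q = \<gamma> t"
  have q: "q \<in> S" "q \<in> X" using t g by (auto simp: q_def)
  have xq: "d x q = t" "d q z = d x z - t"
    using g(8)[of 0 t] g(8)[of t "d x z"] g t by (auto simp: q_def)
  have "d p q + d x z \<le> max (d p x + d q z) (d p z + d q x) + \<delta>"
    using fp p q g unfolding four_point_def by blast
  then have "d p q \<le> 2 * \<delta>"
    using xq le d0 sym[OF p g(3)] sym[OF q(2) g(3)] nonneg[OF p g(4)] unfolding t_def by linarith
  then show ?thesis using q by blast
qed

lemma four_point_side:
  assumes fp: "four_point X d \<delta>" and d0: "0 \<le> \<delta>"
    and S1: "geodesic X d x y S1" and S2: "geodesic X d y z S2" and S3: "geodesic X d z x S3"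
  shows "S1 \<subseteq> neighborhood X d (2 * \<delta>) (S2 \<union> S3)"
proof
  fix p assume "p \<in> S1"
  then have p: "p \<in> X" "d x p + d p y = d x y" using geodesic_point[OF S1] by auto
  have xyz: "x \<in> X" "y \<in> X" "z \<in> X" using geodesicE[OF S1] geodesicE[OF S2] by metis+
  \<comment> \<open>Since \<open>p\<close> lies on the side, \<open>d x y\<close> splits as
    \<open>d x p + d p y\<close>. Cancelling one summand in either branch of the maximum shows that
    \<open>p\<close> is almost between \<open>y\<close> and \<open>z\<close>, or almost between
    \<open>x\<close> and \<open>z\<close>.\<close>
  have "d p z + d x y \<le> max (d p x + d z y) (d p y + d z x) + \<delta>"
    using fp p xyz unfolding four_point_def by blast
  then consider "d y p + d p z \<le> d y z + \<delta>" | "d x p + d p z \<le> d x z + \<delta>"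
    using p xyz sym[of p x] sym[of y p] sym[of y z] sym[of x z] by (auto simp: max_def split: if_splits)
  then show "p \<in> neighborhood X d (2 * \<delta>) (S2 \<union> S3)"
  proof cases
    case 1
    show ?thesis using four_point_near_side[OF fp d0 S2 p(1) 1] p(1) unfolding neighborhood_def by blast
  next
    case 2
    show ?thesis using four_point_near_side[OF fp d0 geodesic_swap[OF S3] p(1) 2] p(1)
      unfolding neighborhood_def by blast
  qed
qed

lemma four_point_imp_hyperbolic:
  assumes "four_point X d \<delta>"
  shows "hyperbolic X d"
proof -
  have fp: "four_point X d \<bar>\<delta>\<bar>"
    using assms unfolding four_point_def by (smt (verit))
  have "delta_hyperbolic X d (2 * \<bar>\<delta>\<bar>)"
    unfolding delta_hyperbolic_def thin_def
    by (intro ballI allI impI conjI) (rule four_point_side[OF fp]; simp)+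
  then show ?thesis unfolding hyperbolic_def by (intro exI[of _ "2 * \<bar>\<delta>\<bar>"]) simp
qed

section \<open>From thin triangles to the four-point inequality\<close>

text \<open>
  Walking along the side from \<open>x\<close> to \<open>y\<close>, one stays near the side \<open>zx\<close> up to the
  supremum and is near the side \<open>yz\<close> just after it.
\<close>

lemma thin_triangle_centre:
  assumes h: "delta_hyperbolic X d \<delta>" and d0: "0 \<le> \<delta>"
    and geo: "\<And>u v. u \<in> X \<Longrightarrow> v \<in> X \<Longrightarrow> \<exists>S. geodesic X d u v S"
    and S1: "geodesic X d x y S1" and z: "z \<in> X"
  shows "\<exists>p\<in>S1. d x p + d p z \<le> d x z + 2 * \<delta> + 4 \<and> d y p + d p z \<le> d y z + 2 * \<delta> + 4"
proof -
  obtain \<gamma> where g: "S1 = \<gamma> ` {0..d x y}" "S1 \<subseteq> X" "x \<in> X" "y \<in> X" "0 \<le> d x y"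
    "\<gamma> 0 = x" "\<gamma> (d x y) = y"
    "\<And>s t. s \<in> {0..d x y} \<Longrightarrow> t \<in> {0..d x y} \<Longrightarrow> d (\<gamma> s) (\<gamma> t) = \<bar>s - t\<bar>"
    using geodesicE[OF S1] by metis
  obtain S2 S3 where S2: "geodesic X d y z S2" and S3: "geodesic X d z x S3"
    using geo g z by metis
  have "thin X d \<delta> S1 S2 S3"
    using h S1 S2 S3 g(3,4) z unfolding delta_hyperbolic_def by blast
  then have near: "(\<exists>a\<in>S2. d p a \<le> \<delta>) \<or> (\<exists>a\<in>S3. d p a \<le> \<delta>)" if "p \<in> S1" for p
    using that unfolding thin_def neighborhood_def by blast
  define A where "A = {t\<in>{0..d x y}. \<exists>a\<in>S3. d (\<gamma> t) a \<le> \<delta>}"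
  have A0: "0 \<in> A"
    using geodesic_ends(2)[OF S3] g d0 refl[of x] by (auto simp: A_def intro!: bexI[of _ x])
  have bdd: "bdd_above A" by (auto simp: A_def intro!: bdd_aboveI[of _ "d x y"])
  have "\<exists>t1\<in>A. Sup A - 1 < t1" using A0 bdd by (subst less_cSup_iff[symmetric]) auto
  then obtain t1 where t1: "t1 \<in> A" "Sup A - 1 < t1" by blast
  have t1': "t1 \<le> Sup A" using t1 bdd by (simp add: cSup_upper)
  have "Sup A \<le> d x y" using A0 by (intro cSup_least) (auto simp: A_def)
  moreover have "0 \<le> Sup A" using A0 bdd by (simp add: cSup_upper)
  ultimately have SA: "Sup A \<in> {0..d x y}" by simp
  \<comment> \<open>Overshooting by 1 leaves \<open>A\<close>, unless it is stopped at
    \<open>y\<close>, which lies on \<open>S2\<close> anyway. As \<open>t1\<close> exceeds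
    \<open>Sup A - 1\<close>, the two parameters differ by at most 2; this accounts for the constant
    4 and avoids asking whether \<open>A\<close> is closed.\<close>
  define t2 where "t2 = min (Sup A + 1) (d x y)"
  have t2: "t2 \<in> {0..d x y}" using SA by (auto simp: t2_def)
  define p where "p = \<gamma> t2"
  have p: "p \<in> S1" "p \<in> X" using t2 g by (auto simp: p_def)
  have "\<exists>a\<in>S2. d p a \<le> \<delta>"
  proof (cases "t2 = d x y")
    case True
    then show ?thesis using geodesic_ends(1)[OF S2] g d0 refl[of y] by (auto simp: p_def intro!: bexI[of _ y])
  next
    case False
    then have "Sup A < t2" by (auto simp: t2_def)
    then have "t2 \<notin> A" using bdd cSup_upper by fastforce
    then show ?thesis using near[OF p(1)] t2 by (auto simp: A_def p_def)
  qed
  then obtain a where a: "a \<in> S2" "d p a \<le> \<delta>" by blast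
  obtain b where b: "b \<in> S3" "d (\<gamma> t1) b \<le> \<delta>" and t1i: "t1 \<in> {0..d x y}" using t1 by (auto simp: A_def)
  have "d p (\<gamma> t1) \<le> 2" using g(8)[OF t2 t1i] t1 t1' SA by (auto simp: p_def t2_def)
  moreover have "\<gamma> t1 \<in> X" "b \<in> X" using t1i g geodesic_point[OF S3 b(1)] by auto
  ultimately have "d p b \<le> \<delta> + 2" using triangle[of p "\<gamma> t1" b] p b by simp
  then have "d x p + d p z \<le> d x z + 2 * (\<delta> + 2)"
    by (rule geodesic_near_point[OF geodesic_swap[OF S3] b(1) p(2)])
  moreover have "d y p + d p z \<le> d y z + 2 * \<delta>"
    by (rule geodesic_near_point[OF S2 a(1) p(2) a(2)])
  ultimately show ?thesis using p by (intro bexI[of _ p]) auto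
qed

text \<open>The centres \<open>p\<close> for \<open>z\<close> and \<open>q\<close> for
  \<open>w\<close> lie on the same geodesic from \<open>x\<close> to \<open>y\<close>. If
  \<open>p\<close> comes first, the routes from \<open>y\<close> to \<open>z\<close> via
  \<open>p\<close> and from \<open>x\<close> to \<open>w\<close> via \<open>q\<close> together cover
  that geodesic once and the stretch from \<open>p\<close> to \<open>q\<close> a second time, which
  leaves room for a route from \<open>z\<close> to \<open>w\<close>. The other order exchanges
  \<open>z\<close> and \<open>w\<close>. Each of the two detours costs
  \<open>2 * \<delta> + 4\<close>.\<close>

lemma hyperbolic_imp_four_point:
  assumes "hyperbolic X d"
    and geo: "\<And>u v. u \<in> X \<Longrightarrow> v \<in> X \<Longrightarrow> \<exists>S. geodesic X d u v S"
  shows "\<exists>\<delta>. four_point X d \<delta>"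
proof -
  obtain \<delta> where h: "delta_hyperbolic X d \<delta>" and d0: "0 \<le> \<delta>"
    using assms(1) unfolding hyperbolic_def by blast
  have "d x y + d z w \<le> max (d x z + d y w) (d x w + d y z) + (4 * \<delta> + 8)"
    if X: "x \<in> X" "y \<in> X" "z \<in> X" "w \<in> X" for x y z w
  proof -
    obtain S where S: "geodesic X d x y S" using geo X by blast
    obtain \<gamma> where g: "S = \<gamma> ` {0..d x y}" "S \<subseteq> X" "0 \<le> d x y" "\<gamma> 0 = x" "\<gamma> (d x y) = y"
      "\<And>s t. s \<in> {0..d x y} \<Longrightarrow> t \<in> {0..d x y} \<Longrightarrow> d (\<gamma> s) (\<gamma> t) = \<bar>s - t\<bar>"
      using geodesicE[OF S] by metis
    obtain p where p: "p \<in> S" "d x p + d p z \<le> d x z + 2 * \<delta> + 4" "d y p + d p z \<le> d y z + 2 * \<delta> + 4"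
      using thin_triangle_centre[OF h d0 geo S X(3)] by blast
    obtain q where q: "q \<in> S" "d x q + d q w \<le> d x w + 2 * \<delta> + 4" "d y q + d q w \<le> d y w + 2 * \<delta> + 4"
      using thin_triangle_centre[OF h d0 geo S X(4)] by blast
    obtain s where s: "s \<in> {0..d x y}" "p = \<gamma> s" using p g by blast
    obtain t where t: "t \<in> {0..d x y}" "q = \<gamma> t" using q g by blast
    have "d x p = s" "d y p = d x y - s" "d x q = t" "d y q = d x y - t" "d p q = \<bar>s - t\<bar>"
      using g(6)[of 0 s] g(6)[of "d x y" s] g(6)[of 0 t] g(6)[of "d x y" t] g(6)[of s t] g(3-5) s t
      by auto
    moreover have "d z w \<le> d p z + d p q + d q w"
      using triangle[of z p w] triangle[of p q w] sym[of z p] X p q g by fastforce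
    ultimately show ?thesis using p q by (cases "s \<le> t") auto
  qed
  then show ?thesis unfolding four_point_def by blast
qed

section \<open>Transfer between metrics at bounded distance\<close>

text \<open>Replacing each point by a nearby one in \<open>Y\<close> and \<open>d\<close> by
  \<open>d'\<close> changes a distance by at most \<open>C + 2 * r\<close>. The inequality compares
  two distances with two others, so the error enters four times.\<close>

lemma four_point_dense_subset:
  assumes sub: "Y \<subseteq> X" and fp: "four_point Y d' \<delta>"
    and close: "\<And>x y. x \<in> Y \<Longrightarrow> y \<in> Y \<Longrightarrow> \<bar>d x y - d' x y\<bar> \<le> C"
    and dense: "\<And>x. x \<in> X \<Longrightarrow> \<exists>y\<in>Y. d x y \<le> r"
  shows "four_point X d (\<delta> + 4 * C + 8 * r)"
proof -
  obtain f where f: "\<And>x. x \<in> X \<Longrightarrow> f x \<in> Y" "\<And>x. x \<in> X \<Longrightarrow> d x (f x) \<le> r"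
    using bchoice[of X "\<lambda>x y. y \<in> Y \<and> d x y \<le> r"] dense by blast
  have *: "\<bar>d x y - d' (f x) (f y)\<bar> \<le> C + 2 * r" if "x \<in> X" "y \<in> X" for x y
  proof -
    have fX: "f x \<in> X" "f y \<in> X" using f(1) sub that by blast+
    show ?thesis
      using triangle[OF that(1) fX(1) that(2)] triangle[OF fX that(2)] triangle[OF fX(1) that(1) fX(2)]
        triangle[OF that fX(2)] sym[OF fX(1) that(1)] sym[OF fX(2) that(2)] f(2)[OF that(1)] f(2)[OF that(2)]
        close[OF f(1)[OF that(1)] f(1)[OF that(2)]] by linarith
  qed
  have "d x y + d z w \<le> max (d x z + d y w) (d x w + d y z) + (\<delta> + 4 * C + 8 * r)"
    if X: "x \<in> X" "y \<in> X" "z \<in> X" "w \<in> X" for x y z w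
  proof -
    have "d' (f x) (f y) + d' (f z) (f w) \<le>
        max (d' (f x) (f z) + d' (f y) (f w)) (d' (f x) (f w) + d' (f y) (f z)) + \<delta>"
      using fp f(1) X unfolding four_point_def by blast
    then show ?thesis
      using *[OF X(1,2)] *[OF X(3,4)] *[OF X(1,3)] *[OF X(2,4)] *[OF X(1,4)] *[OF X(2,3)]
      by linarith
  qed
  then show ?thesis unfolding four_point_def by blast
qed

end

section \<open>The path metric\<close>

lemma edge_point_simps [simp]:
  "edge_point G e 0 = Vertex (end0 G e)" "edge_point G e 1 = Vertex (end1 G e)"
  by (auto simp: edge_point_def)

lemma edge_point_in_points:
  "wf_graph G \<Longrightarrow> e \<in> edges G \<Longrightarrow> t \<in> {0..1} \<Longrightarrow> edge_point G e t \<in> points G"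
  by (auto simp: points_def edge_point_def wf_graph_def)

lemma pointsE:
  assumes "x \<in> points G"
  obtains v where "v \<in> verts G" "x = Vertex v"
  | e t where "e \<in> edges G" "t \<in> {0<..<1}" "x = edge_point G e t"
  using assms by (fastforce simp: points_def edge_point_def)

lemma path_length_in_points:
  "path_length G x l y \<Longrightarrow> wf_graph G \<Longrightarrow> x \<in> points G \<and> y \<in> points G"
  by (induction rule: path_length.induct) (auto simp: edge_point_in_points)

lemma path_length_nonneg: "path_length G x l y \<Longrightarrow> 0 \<le> l"
  by (induction rule: path_length.induct) auto

lemma path_length_edge:
  "wf_graph G \<Longrightarrow> e \<in> edges G \<Longrightarrow> s \<in> {0..1} \<Longrightarrow> t \<in> {0..1} \<Longrightarrow>
   path_length G (edge_point G e s) \<bar>s - t\<bar> (edge_point G e t)"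
  using segment[OF trivial[OF edge_point_in_points]] by fastforce

lemma path_length_trans:
  "path_length G y b z \<Longrightarrow> path_length G x a y \<Longrightarrow> path_length G x (a + b) z"
proof (induction rule: path_length.induct)
  case (segment y l e s t)
  then show ?case using path_length.segment[of G x "a + l" e s t] by (simp add: add.assoc)
qed simp

lemma path_length_sym:
  assumes "wf_graph G" "path_length G x l y"
  shows "path_length G y l x"
  using assms(2)
proof (induction rule: path_length.induct)
  case (segment x l e s t)
  then show ?case
    using path_length_trans[OF segment.IH path_length_edge[OF assms(1), of e t s]]
    by (simp add: abs_minus_commute add.commute)
qed (rule path_length.trivial)

lemma adjacent_path_length:
  assumes "wf_graph G" "adjacent G u v"
  shows "path_length G (Vertex u) 1 (Vertex v)"
proof -
  obtain e where e: "e \<in> edges G" "{end0 G e, end1 G e} = {u, v}"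
    using assms(2) unfolding adjacent_def by blast
  then show ?thesis
    using path_length_edge[OF assms(1) e(1), of 0 1] path_length_edge[OF assms(1) e(1), of 1 0]
    by (auto simp: doubleton_eq_iff)
qed

lemma connected_vertex_path:
  assumes "wf_graph G" "(adjacent G)\<^sup>*\<^sup>* u v" "u \<in> verts G"
  shows "\<exists>l. path_length G (Vertex u) l (Vertex v)"
  using assms(2)
proof (induction rule: rtranclp_induct)
  case base
  then show ?case using trivial[of "Vertex u" G] assms(3) by (auto simp: points_def)
next
  case (step y z)
  then show ?case using path_length_trans adjacent_path_length[OF assms(1)] by blast
qed

lemma point_path_to_vertex:
  assumes "wf_graph G" "x \<in> points G"
  shows "\<exists>v\<in>verts G. \<exists>l. path_length G x l (Vertex v)"
  using assms(2)
proof (cases rule: pointsE)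
  case (1 v)
  then show ?thesis using trivial[of x G] assms(2) by blast
next
  case (2 e t)
  then show ?thesis
    using path_length_edge[OF assms(1) 2(1), of t 0] assms(1) by (auto simp: wf_graph_def)
qed

lemma connected_path:
  assumes G: "connected_graph G" and xy: "x \<in> points G" "y \<in> points G"
  shows "\<exists>l. path_length G x l y"
proof -
  have wf: "wf_graph G" using G by (simp add: connected_graph_def)
  obtain u a where u: "u \<in> verts G" "path_length G x a (Vertex u)"
    using point_path_to_vertex[OF wf xy(1)] by blast
  obtain v b where v: "v \<in> verts G" "path_length G y b (Vertex v)"
    using point_path_to_vertex[OF wf xy(2)] by blast
  obtain c where "path_length G (Vertex u) c (Vertex v)"
    using connected_vertex_path[OF wf] G u v unfolding connected_graph_def by blast
  then show ?thesis
    using path_length_trans u v path_length_sym[OF wf] by blast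
qed

section \<open>Attainment of the infimum\<close>

text \<open>Position inside an edge modulo integers: both ends count as 0, so the value at a vertex
  does not depend on the edge through which it is reached.\<close>

fun coord :: "('v, 'e) point \<Rightarrow> real" where
  "coord (Vertex v) = 0"
| "coord (Interior e t) = t"

text \<open>
  Lengths of paths that never turn round inside an edge lie in the discrete set \<open>combs\<close> of
  the coordinates of the two ends; hence the infimum in \<open>graph_dist\<close> is attained.
\<close>

definition combs :: "real \<Rightarrow> real \<Rightarrow> real set" where
  "combs a b = {of_int m + of_int i * a + of_int j * b | m i j. i \<in> {-1..1} \<and> j \<in> {-1..1}}"

lemma combsI: "i \<in> {-1..1} \<Longrightarrow> j \<in> {-1..1} \<Longrightarrow> l = of_int m + of_int i * a + of_int j * b \<Longrightarrow> l \<in> combs a b"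
  unfolding combs_def by blast

lemma finite_combs:
  assumes "\<bar>a\<bar> \<le> 1" "\<bar>b\<bar> \<le> 1"
  shows "finite {l \<in> combs a b. 0 \<le> l \<and> l \<le> M}"
proof (rule finite_subset)
  let ?f = "\<lambda>(m, i, j). real_of_int m + of_int i * a + of_int j * b"
  show "finite (?f ` ({-2..\<lceil>M\<rceil> + 2} \<times> {-1..1} \<times> {-1..1}))" by simp
  show "{l \<in> combs a b. 0 \<le> l \<and> l \<le> M} \<subseteq> ?f ` ({-2..\<lceil>M\<rceil> + 2} \<times> {-1..1} \<times> {-1..1})"
  proof
    fix l assume "l \<in> {l \<in> combs a b. 0 \<le> l \<and> l \<le> M}"
    then obtain m i j where l: "l = of_int m + of_int i * a + of_int j * b" "0 \<le> l" "l \<le> M"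
      and ij: "i \<in> {-1..1}" "j \<in> {-1..1}" unfolding combs_def by blast
    have bound: "\<bar>of_int k * c\<bar> \<le> 1" if "k \<in> {-1..1}" "\<bar>c\<bar> \<le> 1" for k :: int and c :: real
    proof -
      have "k = -1 \<or> k = 0 \<or> k = 1" using that(1) by auto
      then show ?thesis using that(2) by auto
    qed
    have "real_of_int m \<ge> - 2" "real_of_int m \<le> M + 2"
      using l bound[OF ij(1) assms(1)] bound[OF ij(2) assms(2)] by linarith+
    then have "m \<in> {-2..\<lceil>M\<rceil> + 2}" by (auto, linarith+)
    then show "l \<in> ?f ` ({-2..\<lceil>M\<rceil> + 2} \<times> {-1..1} \<times> {-1..1})"
      using l ij by (intro image_eqI[of _ _ "(m, i, j)"]) auto
  qed
qed

lemma edge_point_coord: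
  assumes "t \<in> {0..1}"
  shows "(\<exists>v. edge_point G e t = Vertex v) \<and> t \<in> {0, 1} \<or>
    edge_point G e t = Interior e t \<and> t \<in> {0<..<1}"
  using assms by (auto simp: edge_point_def)

lemma edge_length_combs:
  assumes "s \<in> {0..1}" "t \<in> {0..1}"
  shows "\<bar>s - t\<bar> \<in> combs (coord (edge_point G e s)) (coord (edge_point G e t))"
proof -
  \<comment> \<open>A signed edge parameter is an integer at a vertex and plus or minus the
    coordinate in the interior. Applied to both ends of a segment with opposite signs, this puts its
    length into \<open>combs\<close>.\<close>
  have sg: "\<exists>m i :: int. i \<in> {-1..1} \<and> a * r = of_int m + of_int i * coord (edge_point G e r)"
    if ra: "r \<in> {0..1}" "a \<in> {-1, 1}" for a r :: real
  proof -
    consider v where "edge_point G e r = Vertex v" "a * r \<in> {-1, 0, 1}" | "edge_point G e r = Interior e r"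
      using edge_point_coord[OF ra(1), of G e] ra(2) by fastforce
    then show ?thesis
    proof cases
      case 1
      then have "a * r = of_int \<lfloor>a * r\<rfloor>" by auto
      then show ?thesis using 1 by (intro exI[of _ "\<lfloor>a * r\<rfloor>"] exI[of _ 0]) auto
    next
      case 2
      obtain k :: int where k: "k \<in> {-1..1}" "a = of_int k"
        using ra(2) that[of 1] that[of "-1"] by auto
      have "a * r = of_int 0 + of_int k * coord (edge_point G e r)" using 2 k by simp
      then show ?thesis using k(1) by blast
    qed
  qed
  obtain a :: real where a: "a \<in> {-1, 1}" "\<bar>s - t\<bar> = a * s + (- a) * t"
  proof (cases "s \<ge> t")
    case True then show thesis by (intro that[of 1]) auto
  next
    case False then show thesis by (intro that[of "-1"]) auto
  qed
  obtain m i where mi: "i \<in> {-1..1}" "a * s = of_int m + of_int i * coord (edge_point G e s)"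
    using sg[OF assms(1) a(1)] by blast
  obtain n j where nj: "j \<in> {-1..1}" "- a * t = of_int n + of_int j * coord (edge_point G e t)"
    using sg[OF assms(2), of "- a"] a(1) by auto
  show ?thesis using a mi nj by (intro combsI[OF mi(1) nj(1), of _ "m + n"]) auto
qed

text \<open>Used to concatenate at a vertex: the middle coordinate is 0, so its two terms vanish
  instead of building up larger coefficients.\<close>

lemma combs_zero_trans:
  assumes "l \<in> combs a 0" "k \<in> combs 0 b"
  shows "l + k \<in> combs a b"
proof -
  obtain m i where 1: "l = of_int m + of_int i * a" "i \<in> {-1..1}" using assms(1) by (auto simp: combs_def)
  obtain n j where 2: "k = of_int n + of_int j * b" "j \<in> {-1..1}" using assms(2) by (auto simp: combs_def)
  show ?thesis using 1 2 by (intro combsI[OF 1(2) 2(2), of _ "m + n"]) auto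
qed

text \<open>
  A path that turns round inside an edge can be shortened. Quantifying over all points of the last
  edge makes the induction work.
\<close>

lemma path_length_shorten_edge:
  assumes "path_length G x l y" "wf_graph G" "y = edge_point G e s" "e \<in> edges G" "s \<in> {0..1}" "t \<in> {0..1}"
  shows "\<exists>l'. l' \<le> l + \<bar>s - t\<bar> \<and> path_length G x l' (edge_point G e t) \<and>
    l' \<in> combs (coord x) (coord (edge_point G e t))"
  using assms
proof (induction arbitrary: e s t rule: path_length.induct)
  case (trivial x)
  then show ?case
    using path_length_edge[of G e s t] edge_length_combs[of s t G e] by (intro exI[of _ "\<bar>s - t\<bar>"]) auto
next
  case (segment x l e0 s0 t0)
  \<comment> \<open>If the last path point is interior to \<open>e\<close>, the previous segment
    also lies in \<open>e\<close>, and both segments are replaced by a single one from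
    \<open>s0\<close> to \<open>t\<close>. If it is a vertex, the shortened path so far and the new
    segment can simply be concatenated.\<close>
  consider "edge_point G e s = Interior e s" "e0 = e" "t0 = s" | v where "edge_point G e s = Vertex v"
    using edge_point_coord[OF segment.prems(4), of G e] edge_point_coord[OF \<open>t0 \<in> {0..1}\<close>, of G e0]
      segment.prems(2) by auto
  then show ?case
  proof cases
    case 1
    obtain l' where "l' \<le> l + \<bar>s0 - t\<bar>" "path_length G x l' (edge_point G e t)"
      "l' \<in> combs (coord x) (coord (edge_point G e t))"
      using segment.IH[of e0 s0 t] segment.prems segment.hyps 1 by blast
    then show ?thesis using 1 by (intro exI[of _ l']) auto
  next
    case 2
    obtain l' where l': "l' \<le> l + \<bar>s0 - t0\<bar>" "path_length G x l' (edge_point G e s)"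
      "l' \<in> combs (coord x) (coord (edge_point G e s))"
      using segment.IH[of e0 s0 t0] segment.prems segment.hyps by auto
    have "path_length G x (l' + \<bar>s - t\<bar>) (edge_point G e t)"
      using l' segment.prems by (intro path_length.segment) auto
    moreover have "l' + \<bar>s - t\<bar> \<in> combs (coord x) (coord (edge_point G e t))"
      using combs_zero_trans l'(3) edge_length_combs[OF segment.prems(4,5), of G e] 2 by simp
    ultimately show ?thesis using l' by (intro exI[of _ "l' + \<bar>s - t\<bar>"]) auto
  qed
qed

lemma path_length_shorten_combs:
  assumes "path_length G x l y" "wf_graph G"
  shows "\<exists>l'\<le>l. path_length G x l' y \<and> l' \<in> combs (coord x) (coord y)"
  using assms(1)
proof (cases rule: path_length.cases)
  case trivial
  have "0 \<in> combs (coord x) (coord x)" by (rule combsI[of 0 0 _ 0]) auto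
  then show ?thesis using assms(1) trivial by (intro exI[of _ 0]) auto
next
  case (segment l0 e s t)
  then show ?thesis using path_length_shorten_edge[OF assms, of e t t] by simp
qed

lemma coord_bounded: "x \<in> points G \<Longrightarrow> \<bar>coord x\<bar> \<le> 1"
  by (auto simp: points_def)

lemma graph_dist_le: "path_length G x l y \<Longrightarrow> graph_dist G x y \<le> l"
  unfolding graph_dist_def
  by (rule cInf_lower) (auto intro!: bdd_belowI[of _ 0] path_length_nonneg)

text \<open>Every path is at least as long as some path with length in \<open>combs\<close>, and
  only finitely many such lengths lie below that of a given path; the least of them is the
  distance.\<close>

lemma graph_dist_attained:
  assumes G: "connected_graph G" and xy: "x \<in> points G" "y \<in> points G"
  shows "path_length G x (graph_dist G x y) y"
proof -
  have wf: "wf_graph G" using G by (simp add: connected_graph_def)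
  obtain l0 where l0: "path_length G x l0 y" using connected_path[OF assms] by blast
  define F where "F = {l. path_length G x l y \<and> l \<in> combs (coord x) (coord y) \<and> l \<le> l0}"
  have "finite F"
    by (rule finite_subset[OF _ finite_combs[OF coord_bounded[OF xy(1)] coord_bounded[OF xy(2)], of l0]])
      (auto simp: F_def path_length_nonneg)
  moreover have "F \<noteq> {}" using path_length_shorten_combs[OF l0 wf] by (auto simp: F_def)
  ultimately have Min: "Min F \<in> F" "\<And>l. l \<in> F \<Longrightarrow> Min F \<le> l" by auto
  have low: "Min F \<le> l" if l: "path_length G x l y" for l
  proof -
    obtain l' where "l' \<le> l" "path_length G x l' y" "l' \<in> combs (coord x) (coord y)"
      using path_length_shorten_combs[OF l wf] by blast
    then show ?thesis using Min by (cases "l' \<le> l0") (force simp: F_def)+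
  qed
  have "graph_dist G x y = Min F"
    unfolding graph_dist_def using Min(1) low by (intro cInf_eq_minimum) (auto simp: F_def)
  then show ?thesis using Min(1) by (simp add: F_def)
qed

lemma pseudometric_graph_dist:
  assumes G: "connected_graph G"
  shows "pseudometric (points G) (graph_dist G)"
proof
  have wf: "wf_graph G" using G by (simp add: connected_graph_def)
  note att = graph_dist_attained[OF G]
  fix x y z assume x: "x \<in> points G"
  show "graph_dist G x x = 0"
    using graph_dist_le[OF trivial[OF x]] path_length_nonneg[OF att[OF x x]] by simp
  assume y: "y \<in> points G"
  show "graph_dist G x y = graph_dist G y x"
    using graph_dist_le[OF path_length_sym[OF wf att[OF x y]]]
      graph_dist_le[OF path_length_sym[OF wf att[OF y x]]] by simp
  assume z: "z \<in> points G"
  show "graph_dist G x z \<le> graph_dist G x y + graph_dist G y z"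
    using graph_dist_le[OF path_length_trans[OF att[OF y z] att[OF x y]]] .
qed

section \<open>Existence of geodesics\<close>

text \<open>An arc-length parametrisation. Asking for a path of the right length on every stretch,
  not only from the start, gives the upper bounds needed for an isometry.\<close>

lemma path_length_curve:
  assumes "path_length G x l y" "wf_graph G"
  shows "\<exists>\<gamma>. \<gamma> 0 = x \<and> \<gamma> l = y \<and>
    (\<forall>s t. 0 \<le> s \<longrightarrow> s \<le> t \<longrightarrow> t \<le> l \<longrightarrow> path_length G (\<gamma> s) (t - s) (\<gamma> t))"
  using assms(1)
proof (induction rule: path_length.induct)
  case (trivial x)
  have "path_length G x (t - s) x" if "0 \<le> s" "s \<le> t" "t \<le> 0" for s t
  proof -
    have "t = s" using that by linarith
    then show ?thesis using path_length.trivial[OF trivial] by simp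
  qed
  then show ?case by (intro exI[of _ "\<lambda>_. x"]) blast
next
  case (segment x l e a b)
  then obtain \<gamma> where g: "\<gamma> 0 = x" "\<gamma> l = edge_point G e a"
    "\<And>s t. 0 \<le> s \<Longrightarrow> s \<le> t \<Longrightarrow> t \<le> l \<Longrightarrow> path_length G (\<gamma> s) (t - s) (\<gamma> t)" by blast
  have l0: "0 \<le> l" using segment.hyps(1) by (rule path_length_nonneg)
  define c where "c u = (if a \<le> b then a + u else a - u)" for u :: real
  have c: "c u \<in> {0..1}" if "u \<in> {0..\<bar>a - b\<bar>}" for u
    using that segment.hyps by (auto simp: c_def)
  have c': "\<bar>c u - c v\<bar> = \<bar>u - v\<bar>" "c 0 = a" "c \<bar>a - b\<bar> = b" for u v by (auto simp: c_def)
  define \<gamma>' where "\<gamma>' u = (if u \<le> l then \<gamma> u else edge_point G e (c (u - l)))" for u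
  \<comment> \<open>The junction \<open>u = l\<close> is included because both formulas agree there;
    \<open>seg\<close> can then start exactly at \<open>l\<close>.\<close>
  have late: "\<gamma>' u = edge_point G e (c (u - l))" if "l \<le> u" for u
    using that g c' by (auto simp: \<gamma>'_def)
  have seg: "path_length G (\<gamma>' s) (t - s) (\<gamma>' t)" if "l \<le> s" "s \<le> t" "t \<le> l + \<bar>a - b\<bar>" for s t
    using path_length_edge[OF assms(2) \<open>e \<in> edges G\<close> c[of "s - l"] c[of "t - l"]] that c'(1)[of "s - l" "t - l"]
    by (auto simp: late)
  have "path_length G (\<gamma>' s) (t - s) (\<gamma>' t)" if st: "0 \<le> s" "s \<le> t" "t \<le> l + \<bar>a - b\<bar>" for s t
  proof -
    consider "t \<le> l" | "l \<le> s" | "s \<le> l" "l \<le> t" by linarith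
    then show ?thesis
    proof cases
      case 1
      then show ?thesis using g(3)[of s t] st by (simp add: \<gamma>'_def)
    next
      case 2
      then show ?thesis using seg st by simp
    next
      case 3
      have "path_length G (\<gamma>' s) (l - s) (\<gamma>' l)" using g(3)[of s l] st 3 by (simp add: \<gamma>'_def)
      from path_length_trans[OF seg[of l t] this] show ?thesis using st 3 by simp
    qed
  qed
  moreover have "\<gamma>' 0 = x" "\<gamma>' (l + \<bar>a - b\<bar>) = edge_point G e b"
    using g l0 late[of "l + \<bar>a - b\<bar>"] c' by (auto simp: \<gamma>'_def)
  ultimately show ?case by blast
qed

lemma graph_geodesic_exists:
  assumes G: "connected_graph G" and xy: "x \<in> points G" "y \<in> points G"
  shows "\<exists>S. geodesic (points G) (graph_dist G) x y S"
proof -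
  interpret pseudometric "points G" "graph_dist G" by (rule pseudometric_graph_dist[OF G])
  have wf: "wf_graph G" using G by (simp add: connected_graph_def)
  let ?d = "graph_dist G" and ?l = "graph_dist G x y"
  have l0: "0 \<le> ?l" using nonneg xy by blast
  obtain \<gamma> where g: "\<gamma> 0 = x" "\<gamma> ?l = y"
    "\<And>s t. 0 \<le> s \<Longrightarrow> s \<le> t \<Longrightarrow> t \<le> ?l \<Longrightarrow> path_length G (\<gamma> s) (t - s) (\<gamma> t)"
    using path_length_curve[OF graph_dist_attained[OF assms] wf] by blast
  have pts: "\<gamma> s \<in> points G" if "s \<in> {0..?l}" for s
    using path_length_in_points[OF g(3)[of s s] wf] that by auto
  \<comment> \<open>The three stretches have distances at most their parameter lengths, and these
    lengths add up to the distance from \<open>x\<close> to \<open>y\<close>. By the triangle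
    inequality no stretch can be shorter.\<close>
  have iso: "?d (\<gamma> s) (\<gamma> t) = t - s" if st: "0 \<le> s" "s \<le> t" "t \<le> ?l" for s t
  proof -
    have "?d x (\<gamma> s) \<le> s" "?d (\<gamma> s) (\<gamma> t) \<le> t - s" "?d (\<gamma> t) y \<le> ?l - t"
      using graph_dist_le[OF g(3)[of 0 s]] graph_dist_le[OF g(3)[of s t]] graph_dist_le[OF g(3)[of t ?l]] g st
      by auto
    moreover have "?l \<le> ?d x (\<gamma> s) + ?d (\<gamma> s) (\<gamma> t) + ?d (\<gamma> t) y"
      using triangle[of x "\<gamma> s" y] triangle[of "\<gamma> s" "\<gamma> t" y] pts[of s] pts[of t] st xy by simp
    ultimately show ?thesis by linarith
  qed
  have "?d (\<gamma> s) (\<gamma> t) = \<bar>s - t\<bar>" if "s \<in> {0..?l}" "t \<in> {0..?l}" for s t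
    using iso[of s t] iso[of t s] sym[of "\<gamma> s" "\<gamma> t"] pts that by (cases "s \<le> t") auto
  then show ?thesis unfolding geodesic_def using g l0 pts by blast
qed

lemma hyperbolic_graph_iff_four_point:
  assumes G: "connected_graph G"
  shows "hyperbolic_graph G \<longleftrightarrow> (\<exists>\<delta>. four_point (points G) (graph_dist G) \<delta>)"
  using pseudometric.four_point_imp_hyperbolic[OF pseudometric_graph_dist[OF G]]
    pseudometric.hyperbolic_imp_four_point[OF pseudometric_graph_dist[OF G] _ graph_geodesic_exists[OF G]]
  by blast

section \<open>Removal and contraction change distances by a bounded amount\<close>

text \<open>This replaces path surgery: to bound one distance by another, take for
  \<open>\<Phi>\<close> the distance from a fixed point in the other graph, or a variant of
  it.\<close>

lemma lipschitz_le_path_length: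
  assumes "path_length G x l y"
    and "\<And>e s t. e \<in> edges G \<Longrightarrow> s \<in> {0..1} \<Longrightarrow> t \<in> {0..1} \<Longrightarrow>
      \<Phi> (edge_point G e t) \<le> \<Phi> (edge_point G e s) + \<bar>s - t\<bar>"
  shows "\<Phi> y \<le> \<Phi> x + (l :: real)"
  using assms(1)
proof (induction rule: path_length.induct)
  case (segment x l e s t)
  then show ?case using assms(2)[of e s t] by simp
qed simp

lemma lipschitz_le_graph_dist:
  assumes "connected_graph G" "x \<in> points G" "y \<in> points G"
    and "\<And>e s t. e \<in> edges G \<Longrightarrow> s \<in> {0..1} \<Longrightarrow> t \<in> {0..1} \<Longrightarrow>
      \<Phi> (edge_point G e t) \<le> \<Phi> (edge_point G e s) + \<bar>s - t\<bar>"
  shows "\<Phi> y \<le> \<Phi> x + graph_dist G x y"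
  using lipschitz_le_path_length[OF graph_dist_attained[OF assms(1-3)], of \<Phi>] assms(4) by blast

lemma graph_dist_lipschitz:
  assumes G: "connected_graph G" and x: "x \<in> points G"
    and e: "e \<in> edges G" "s \<in> {0..1}" "t \<in> {0..1}"
  shows "graph_dist G x (edge_point G e t) \<le> graph_dist G x (edge_point G e s) + \<bar>s - t\<bar>"
proof -
  have wf: "wf_graph G" using G by (simp add: connected_graph_def)
  show ?thesis
    using graph_dist_le[OF segment[OF graph_dist_attained[OF G x edge_point_in_points[OF wf e(1,2)]] e]] .
qed

text \<open>The distance from \<open>x\<close> after identifying the points \<open>a\<close> and \<open>b\<close>.\<close>

definition glued_dist ::
  "('v, 'e) graph \<Rightarrow> ('v, 'e) point \<Rightarrow> ('v, 'e) point \<Rightarrow> ('v, 'e) point \<Rightarrow> ('v, 'e) point \<Rightarrow> real" where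
  "glued_dist G a b x y = min (graph_dist G x y)
     (min (graph_dist G x a) (graph_dist G x b) + min (graph_dist G a y) (graph_dist G b y))"

context
  fixes G :: "('v, 'e) graph" and a b x :: "('v, 'e) point"
  assumes G: "connected_graph G" and a: "a \<in> points G" and b: "b \<in> points G" and x: "x \<in> points G"
begin

interpretation pseudometric "points G" "graph_dist G" by (rule pseudometric_graph_dist[OF G])

lemma glued_dist_self: "glued_dist G a b x x \<le> 0"
  using refl[OF x] by (simp add: glued_dist_def)

text \<open>The common value lets the glued distance descend to a graph in which \<open>a\<close>
  and \<open>b\<close> are merged, or extend as a constant over an edge joining them.\<close>

lemma glued_dist_eq: "glued_dist G a b x a = glued_dist G a b x b"
  using refl[OF a] refl[OF b] nonneg[OF a b] nonneg[OF b a] by (simp add: glued_dist_def)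

lemma glued_dist_lipschitz:
  assumes "e \<in> edges G" "s \<in> {0..1}" "t \<in> {0..1}"
  shows "glued_dist G a b x (edge_point G e t) \<le> glued_dist G a b x (edge_point G e s) + \<bar>s - t\<bar>"
  using graph_dist_lipschitz[OF G x assms] graph_dist_lipschitz[OF G a assms] graph_dist_lipschitz[OF G b assms]
  unfolding glued_dist_def by linarith

text \<open>The glued distance allows at most one free jump between \<open>a\<close> and
  \<open>b\<close>; an actual path replaces it at cost \<open>graph_dist G a b\<close>.\<close>

lemma graph_dist_le_glued:
  assumes "y \<in> points G"
  shows "graph_dist G x y \<le> glued_dist G a b x y + graph_dist G a b"
  using triangle[OF x a assms] triangle[OF x b assms] triangle[OF a b assms] triangle[OF b a assms]
    sym[OF a b] nonneg[OF a b] unfolding glued_dist_def by linarith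

end

section \<open>A single removal or contraction\<close>

lemma hyperbolic_graph_iff_of_bounded_distortion:
  assumes G: "connected_graph G" and H: "connected_graph H" and sub: "points H \<subseteq> points G"
    and close: "\<And>x y. x \<in> points H \<Longrightarrow> y \<in> points H \<Longrightarrow> \<bar>graph_dist G x y - graph_dist H x y\<bar> \<le> C"
    and dense: "\<And>x. x \<in> points G \<Longrightarrow> \<exists>y\<in>points H. graph_dist G x y \<le> r"
  shows "hyperbolic_graph G \<longleftrightarrow> hyperbolic_graph H"
proof -
  interpret G: pseudometric "points G" "graph_dist G" by (rule pseudometric_graph_dist[OF G])
  interpret H: pseudometric "points H" "graph_dist H" by (rule pseudometric_graph_dist[OF H])
  \<comment> \<open>Here \<open>points H\<close> is both the space and its dense subset, so
    \<open>r = 0\<close> and only the metric changes.\<close>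
  have "four_point (points H) (graph_dist H) (\<delta> + 4 * C + 8 * 0)"
    if fp: "four_point (points G) (graph_dist G) \<delta>" for \<delta>
  proof (rule H.four_point_dense_subset)
    show "four_point (points H) (graph_dist G) \<delta>" using fp sub unfolding four_point_def by blast
    show "\<bar>graph_dist H x y - graph_dist G x y\<bar> \<le> C" if "x \<in> points H" "y \<in> points H" for x y
      using close[OF that] by (simp add: abs_minus_commute)
    show "\<exists>y\<in>points H. graph_dist H x y \<le> 0" if "x \<in> points H" for x
      using that H.refl[OF that] by (intro bexI[of _ x]) auto
  qed simp
  then show ?thesis
    unfolding hyperbolic_graph_iff_four_point[OF G] hyperbolic_graph_iff_four_point[OF H]
    using G.four_point_dense_subset[OF sub _ close dense] by blast
qed

lemma graph_dist_edge_end0: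
  assumes "connected_graph G" "e \<in> edges G" "t \<in> {0..1}"
  shows "graph_dist G (edge_point G e t) (Vertex (end0 G e)) \<le> 1"
proof -
  have "wf_graph G" using assms by (simp add: connected_graph_def)
  from graph_dist_le[OF path_length_edge[OF this assms(2,3), of 0]] show ?thesis using assms by simp
qed

lemma hyperbolic_graph_remove_edge:
  assumes G: "connected_graph G" and H: "connected_graph (remove_edge G e)" and e: "e \<in> edges G"
  shows "hyperbolic_graph G \<longleftrightarrow> hyperbolic_graph (remove_edge G e)"
proof -
  define H' where "H' = remove_edge G e"
  have H: "connected_graph H'" using H by (simp add: H'_def)
  have wf: "wf_graph G" "wf_graph H'" using G H by (auto simp: connected_graph_def)
  define a b :: "('a, 'b) point" where "a = Vertex (end0 G e)" and "b = Vertex (end1 G e)"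
  have ep: "edge_point H' f t = edge_point G f t" for f t by (auto simp: edge_point_def H'_def remove_edge_def)
  have ed: "edges H' = edges G - {e}" by (simp add: H'_def remove_edge_def)
  have pts: "points H' = points G - {Interior e t | t. True}"
    by (auto simp: points_def H'_def remove_edge_def)
  have ab: "a \<in> points H'" "b \<in> points H'" using wf(1) e by (auto simp: a_def b_def points_def wf_graph_def H'_def remove_edge_def)
  interpret G: pseudometric "points G" "graph_dist G" by (rule pseudometric_graph_dist[OF G])
  interpret H: pseudometric "points H'" "graph_dist H'" by (rule pseudometric_graph_dist[OF H])
  \<comment> \<open>All edges of \<open>H'\<close> are edges of \<open>G\<close>, so the distance
    from \<open>x\<close> in \<open>G\<close> is 1-Lipschitz along them.\<close>
  have 1: "graph_dist G x y \<le> graph_dist H' x y" if xy: "x \<in> points H'" "y \<in> points H'" for x y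
  proof -
    have x: "x \<in> points G" using xy pts by blast
    show ?thesis
      using lipschitz_le_graph_dist[OF H xy, of "graph_dist G x"] graph_dist_lipschitz[OF G x] G.refl[OF x]
      by (auto simp: ep ed)
  qed
  have 2: "graph_dist H' x y \<le> graph_dist G x y + graph_dist H' a b"
    if xy: "x \<in> points H'" "y \<in> points H'" for x y
  proof -
    \<comment> \<open>the glued distance, extended to \<open>e\<close> by its common value at both ends\<close>
    define \<Phi> where "\<Phi> z = (case z of
        Vertex v \<Rightarrow> glued_dist H' a b x z
      | Interior f t \<Rightarrow> glued_dist H' a b x (if f = e then a else z))" for z
    have \<Phi>H: "\<Phi> z = glued_dist H' a b x z" if "z \<in> points H'" for z
      using that by (auto simp: pts \<Phi>_def split: point.splits)
    have \<Phi>e: "\<Phi> (edge_point G e t) = glued_dist H' a b x a" for t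
      using glued_dist_eq[OF H ab xy(1)] by (auto simp: edge_point_def \<Phi>_def a_def b_def)
    have "\<Phi> y \<le> \<Phi> x + graph_dist G x y"
    proof (rule lipschitz_le_graph_dist[OF G])
      fix f and s t :: real assume f: "f \<in> edges G" and st: "s \<in> {0..1}" "t \<in> {0..1}"
      show "\<Phi> (edge_point G f t) \<le> \<Phi> (edge_point G f s) + \<bar>s - t\<bar>"
      proof (cases "f = e")
        case False
        then have "f \<in> edges H'" using f ed by blast
        then show ?thesis
          using glued_dist_lipschitz[OF H ab xy(1) _ st] edge_point_in_points[OF wf(2)] st \<Phi>H
          by (simp add: ep)
      qed (simp add: \<Phi>e)
    qed (use xy pts in auto)
    then show ?thesis
      using glued_dist_self[OF H ab xy(1)] graph_dist_le_glued[OF H ab xy] \<Phi>H xy by simp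
  qed
  have "\<exists>y\<in>points H'. graph_dist G x y \<le> 1" if x: "x \<in> points G" for x
  proof (cases "x \<in> points H'")
    case True
    then show ?thesis using G.refl[OF x] by force
  next
    case False
    then obtain t where "x = Interior e t" using x unfolding pts by blast
    then have "x = edge_point G e t" "t \<in> {0..1}" using x by (auto simp: points_def edge_point_def)
    then show ?thesis using graph_dist_edge_end0[OF G e] ab(1) unfolding a_def by blast
  qed
  moreover have "\<bar>graph_dist G x y - graph_dist H' x y\<bar> \<le> graph_dist H' a b"
    if "x \<in> points H'" "y \<in> points H'" for x y
    using 1[OF that] 2[OF that] by linarith
  ultimately show ?thesis
    using hyperbolic_graph_iff_of_bounded_distortion[OF G H] pts unfolding H'_def by blast
qed

lemma hyperbolic_graph_contract_edge:
  assumes G: "connected_graph G" and H: "connected_graph (contract_edge G e)" and e: "e \<in> edges G"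
  shows "hyperbolic_graph G \<longleftrightarrow> hyperbolic_graph (contract_edge G e)"
proof -
  define H' where "H' = contract_edge G e"
  have H: "connected_graph H'" using H by (simp add: H'_def)
  have wf: "wf_graph G" "wf_graph H'" using G H by (auto simp: connected_graph_def)
  define a b :: "('a, 'b) point" where "a = Vertex (end0 G e)" and "b = Vertex (end1 G e)"
  have ed: "edges H' = edges G - {e}" by (simp add: H'_def contract_edge_def)
  have vs: "verts H' = merge_ends G e ` verts G" by (simp add: H'_def contract_edge_def)
  \<comment> \<open>The quotient map collapsing the closed edge \<open>e\<close> to the merged
    vertex. It fixes \<open>points H'\<close> because that vertex keeps the name
    \<open>end0 G e\<close>, and it does not lengthen segments.\<close>
  define \<pi> where "\<pi> z = (case z of Vertex v \<Rightarrow> Vertex (merge_ends G e v)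
      | Interior f t \<Rightarrow> if f = e then a else z)" for z :: "('a, 'b) point"
  have \<pi>_edge: "\<pi> (edge_point G f t) = edge_point H' f t" if "f \<noteq> e" for f t
    using that by (auto simp: edge_point_def H'_def contract_edge_def \<pi>_def)
  have \<pi>_e: "\<pi> (edge_point G e t) = a" for t
    by (auto simp: edge_point_def \<pi>_def a_def merge_ends_def)
  have verts_sub: "verts H' \<subseteq> verts G"
    using wf(1) e by (auto simp: vs merge_ends_def wf_graph_def)
  have sub: "points H' \<subseteq> points G"
    using verts_sub by (auto simp: points_def ed)
  have \<pi>_id: "\<pi> z = z" if "z \<in> points H'" for z
    using that by (auto simp: points_def \<pi>_def vs ed merge_ends_def)
  have "merge_ends G e (end0 G e) \<in> verts H'" using wf(1) e unfolding vs wf_graph_def by blast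
  then have aH: "a \<in> points H'" by (auto simp: points_def a_def merge_ends_def)
  have ab: "a \<in> points G" "b \<in> points G" using wf(1) e by (auto simp: a_def b_def points_def wf_graph_def)
  interpret G: pseudometric "points G" "graph_dist G" by (rule pseudometric_graph_dist[OF G])
  interpret H: pseudometric "points H'" "graph_dist H'" by (rule pseudometric_graph_dist[OF H])
  have 1: "graph_dist H' x y \<le> graph_dist G x y" if xy: "x \<in> points H'" "y \<in> points H'" for x y
  proof -
    have "graph_dist H' x (\<pi> y) \<le> graph_dist H' x (\<pi> x) + graph_dist G x y"
    proof (rule lipschitz_le_graph_dist[OF G])
      fix f and s t :: real assume f: "f \<in> edges G" and st: "s \<in> {0..1}" "t \<in> {0..1}"
      show "graph_dist H' x (\<pi> (edge_point G f t)) \<le> graph_dist H' x (\<pi> (edge_point G f s)) + \<bar>s - t\<bar>"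
        using graph_dist_lipschitz[OF H xy(1) _ st] f by (cases "f = e") (auto simp: \<pi>_edge \<pi>_e ed)
    qed (use xy sub in auto)
    then show ?thesis using \<pi>_id xy H.refl by simp
  qed
  have 2: "graph_dist G x y \<le> graph_dist H' x y + 1" if xy: "x \<in> points H'" "y \<in> points H'" for x y
  proof -
    have xy': "x \<in> points G" "y \<in> points G" using xy sub by auto
    let ?\<Phi> = "glued_dist G a b x"
    \<comment> \<open>Renaming the end \<open>b\<close> to \<open>a\<close> is harmless because the
      glued distance takes the same value at both.\<close>
    have \<Phi>: "?\<Phi> (edge_point H' f t) = ?\<Phi> (edge_point G f t)" for f t
      using glued_dist_eq[OF G ab xy'(1)]
      by (auto simp: edge_point_def H'_def contract_edge_def merge_ends_def a_def b_def)
    have "?\<Phi> y \<le> ?\<Phi> x + graph_dist H' x y"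
      by (rule lipschitz_le_graph_dist[OF H xy]) (simp add: \<Phi> ed glued_dist_lipschitz[OF G ab xy'(1)])
    moreover have "graph_dist G a b \<le> 1"
      using graph_dist_edge_end0[OF G e, of 1] G.sym[OF ab] by (simp add: a_def b_def)
    ultimately show ?thesis
      using glued_dist_self[OF G ab xy'(1)] graph_dist_le_glued[OF G ab xy'] by linarith
  qed
  have "\<exists>y\<in>points H'. graph_dist G x y \<le> 1" if x: "x \<in> points G" for x
  proof (cases "x \<in> points H'")
    case True
    then show ?thesis using G.refl[OF x] by force
  next
    case False
    \<comment> \<open>The points lost by contraction are interior points of \<open>e\<close> and
      possibly its second end; all lie on the closed edge \<open>e\<close>, hence within 1 of
      \<open>a\<close>.\<close>
    have "\<exists>t\<in>{0..1}. x = edge_point G e t"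
      using x
    proof (cases rule: pointsE)
      case (1 v)
      then have "v = end1 G e" using False by (auto simp: points_def vs merge_ends_def image_iff split: if_splits)
      then show ?thesis using 1 by (intro bexI[of _ 1]) auto
    next
      case (2 f t)
      then have "f = e" using False by (auto simp: points_def ed edge_point_def)
      then show ?thesis using 2 by auto
    qed
    then show ?thesis using graph_dist_edge_end0[OF G e] aH unfolding a_def by blast
  qed
  moreover have "\<bar>graph_dist G x y - graph_dist H' x y\<bar> \<le> 1"
    if "x \<in> points H'" "y \<in> points H'" for x y
    using 1[OF that] 2[OF that] by linarith
  ultimately show ?thesis
    using hyperbolic_graph_iff_of_bounded_distortion[OF G H sub] unfolding H'_def by blast
qed

section \<open>Sequences of removals and contractions\<close>

lemma wf_graph_minor_step: "minor_step G H \<Longrightarrow> wf_graph G \<Longrightarrow> wf_graph H"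
  by (induction rule: minor_step.induct) (auto simp: wf_graph_def remove_edge_def contract_edge_def)

lemma adjacent_sym: "adjacent G u v \<Longrightarrow> adjacent G v u"
  by (auto simp: adjacent_def insert_commute)

lemma adjacent_remove_edge: "adjacent (remove_edge G e) u v \<Longrightarrow> adjacent G u v"
  by (auto simp: adjacent_def remove_edge_def)

lemma reachable_merge_ends:
  assumes "e \<in> edges G"
  shows "(adjacent G)\<^sup>*\<^sup>* v (merge_ends G e v)" "(adjacent G)\<^sup>*\<^sup>* (merge_ends G e v) v"
proof -
  have "adjacent G (end0 G e) (end1 G e)" using assms by (auto simp: adjacent_def)
  then show "(adjacent G)\<^sup>*\<^sup>* v (merge_ends G e v)" "(adjacent G)\<^sup>*\<^sup>* (merge_ends G e v) v"
    by (auto simp: merge_ends_def dest: adjacent_sym)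
qed

text \<open>An edge of the contracted graph comes from an edge of \<open>G\<close> whose ends may
  have been renamed; each renaming is undone by a walk along \<open>e\<close>.\<close>

lemma adjacent_contract_edge:
  assumes e: "e \<in> edges G" and uv: "adjacent (contract_edge G e) u v"
  shows "(adjacent G)\<^sup>*\<^sup>* u v"
proof -
  obtain p q where pq: "adjacent G p q" "u = merge_ends G e p" "v = merge_ends G e q"
  proof -
    obtain f where f: "f \<in> edges G"
      "{merge_ends G e (end0 G f), merge_ends G e (end1 G f)} = {u, v}"
      using uv by (auto simp: adjacent_def contract_edge_def)
    have "adjacent G (end0 G f) (end1 G f)" using f by (auto simp: adjacent_def)
    then show thesis using that f(2) adjacent_sym by (metis doubleton_eq_iff)
  qed
  show ?thesis
    using reachable_merge_ends(2)[OF e, of p] reachable_merge_ends(1)[OF e, of q] pq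
    by (meson rtranclp_trans r_into_rtranclp)
qed

lemma connected_graph_minor_step:
  assumes "minor_step G H" "wf_graph G" "connected_graph H"
  shows "connected_graph G"
  using assms(1)
proof cases
  case (remove e)
  have "(adjacent G)\<^sup>*\<^sup>* u v" if "(adjacent H)\<^sup>*\<^sup>* u v" for u v
    using that unfolding remove(1)
  proof (induction rule: rtranclp_induct)
    case (step y z)
    then show ?case using adjacent_remove_edge by (meson rtranclp.rtrancl_into_rtrancl)
  qed simp
  moreover have "verts H = verts G" using remove by (simp add: remove_edge_def)
  ultimately show ?thesis
    using assms(2,3) unfolding connected_graph_def by metis
next
  case (contract e)
  have vs: "verts (contract_edge G e) = merge_ends G e ` verts G" by (simp add: contract_edge_def)
  have step: "(adjacent G)\<^sup>*\<^sup>* u v" if "(adjacent (contract_edge G e))\<^sup>*\<^sup>* u v" for u v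
    using that
  proof (induction rule: rtranclp_induct)
    case (step y z)
    then show ?case using adjacent_contract_edge[OF contract(2)] by (meson rtranclp_trans)
  qed simp
  have "(adjacent G)\<^sup>*\<^sup>* u v" if "u \<in> verts G" "v \<in> verts G" for u v
  proof -
    have "(adjacent (contract_edge G e))\<^sup>*\<^sup>* (merge_ends G e u) (merge_ends G e v)"
      using assms(3) contract(1) that vs unfolding connected_graph_def by blast
    then show ?thesis
      using step reachable_merge_ends(1)[OF contract(2), of u] reachable_merge_ends(2)[OF contract(2), of v]
      by (meson rtranclp_trans)
  qed
  moreover have "verts G \<noteq> {}"
    using assms(3) contract(1) vs unfolding connected_graph_def by blast
  ultimately show ?thesis using assms(2) by (simp add: connected_graph_def)
qed

lemma hyperbolic_graph_minor_step:
  assumes "minor_step G H" "connected_graph G" "connected_graph H"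
  shows "hyperbolic_graph G \<longleftrightarrow> hyperbolic_graph H"
  using assms(1)
proof cases
  case (remove e)
  then show ?thesis using hyperbolic_graph_remove_edge[of G e] assms(2,3) by simp
next
  case (contract e)
  then show ?thesis using hyperbolic_graph_contract_edge[of G e] assms(2,3) by simp
qed

theorem theorem4p7:
  fixes G G' :: "('v, 'e) graph"
  assumes "connected_graph G"
    and "finite_edge_minor G G'"
    and "connected_graph G'"
  shows "hyperbolic_graph G \<longleftrightarrow> hyperbolic_graph G'"
proof -
  \<comment> \<open>Well-formedness passes forward along the steps, connectedness backward. The
    induction prepends steps to the sequence, so the former is a premise and the latter part of the
    conclusion.\<close>
  have "wf_graph G \<longrightarrow> connected_graph G \<and> (hyperbolic_graph G \<longleftrightarrow> hyperbolic_graph G')"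
    using assms(2)
  proof (induction rule: converse_rtranclp_induct)
    case base
    then show ?case using assms(3) by simp
  next
    case (step G H)
    then show ?case
      using wf_graph_minor_step connected_graph_minor_step hyperbolic_graph_minor_step by blast
  qed
  then show ?thesis using assms(1) by (simp add: connected_graph_def)
qed

end
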